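(* Let $S$ be a $(2,\omega)$-divisible Cu-semigroup satisfying (O5), (O6) and (O7). Let $x\in S$ and let $u'\in L_x$. Then there exists $w\in S_{\mathrm{soft}}$ such that $u'\ll w\le x\le\infty w$ and $\lambda(w)=\lambda(x)$ for every $\lambda\in F(S)$.
   Context: A Cu-semigroup is a positively ordered commutative monoid satisfying (O1)–(O4): increasing sequences have suprema; each element is the supremum of a $\ll$-increasing sequence; $x'\ll x,y'\ll y\Rightarrow x'+y'\ll x+y$; suprema of increasing sequences are additive. $x\ll y$ means whenever $y\le\sup z_n$ for an increasing sequence, $x\le z_m$ for some $m$. (O5): if $x+y\le z$, $x'\ll x$, $y'\ll y$ then some $c$ has $y'\ll c$ and $x'+c\le z\le x+c$. (O6): if $x'\ll x\le y+z$ then some $v,w$ have $v\le x,y$, $w\le x,z$, $x'\le v+w$. (O7): if $x'\ll x\le w$ and $y'\ll y\le w$ then some $z$ has $x',y'\ll z\le w,x+y$. $\infty x=\sup_n nx$. $x$ is strongly soft if for every $x'\ll x$ there is $t$ with $x'+t\ll x$ and $x'\ll\infty t$; $S_{\mathrm{soft}}$ is the set of strongly soft elements. $S$ is $(2,\omega)$-divisible if for all $x'\ll x$ there is $y$ with $2y\le x$ and $x'\le\infty y$. $F(S)$ is the set of functionals: monoid morphisms $S\to[0,\infty]$ preserving order and suprema of increasing sequences. For $x\in S$, $L_x:=\{u'\in S:\ u'\ll u\ll x \text{ for some } u\in S_{\mathrm{soft}}\}$. *)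

theory Defs
  imports Main "HOL-Library.Extended_Nonnegative_Real"
begin

definition is_sup :: "(nat \<Rightarrow> 'a::order) \<Rightarrow> 'a \<Rightarrow> bool" where
  "is_sup f s \<longleftrightarrow> (\<forall>n. f n \<le> s) \<and> (\<forall>b. (\<forall>n. f n \<le> b) \<longrightarrow> s \<le> b)"

definition way_below :: "'a::order \<Rightarrow> 'a \<Rightarrow> bool" (infix "\<lless>" 50) where
  "x \<lless> y \<longleftrightarrow> (\<forall>f s. mono f \<longrightarrow> is_sup f s \<longrightarrow> y \<le> s \<longrightarrow> (\<exists>m. x \<le> f m))"

fun nsmul :: "nat \<Rightarrow> 'a::comm_monoid_add \<Rightarrow> 'a" where
  "nsmul 0 x = 0"
| "nsmul (Suc n) x = x + nsmul n x"

definition cu_inf :: "'a::ordered_comm_monoid_add \<Rightarrow> 'a" where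
  "cu_inf x = (THE s. is_sup (\<lambda>n. nsmul n x) s)"

definition cu_semigroup :: "'a::ordered_comm_monoid_add itself \<Rightarrow> bool" where
  "cu_semigroup _ \<longleftrightarrow>
     (\<forall>x::'a. 0 \<le> x) \<and>
     (\<forall>f::nat \<Rightarrow> 'a. mono f \<longrightarrow> (\<exists>s. is_sup f s)) \<and>
     (\<forall>x::'a. \<exists>f. (\<forall>n. f n \<lless> f (Suc n)) \<and> is_sup f x) \<and>
     (\<forall>x' x y' y :: 'a. x' \<lless> x \<longrightarrow> y' \<lless> y \<longrightarrow> x' + y' \<lless> x + y) \<and>
     (\<forall>(f::nat \<Rightarrow> 'a) g s t. mono f \<longrightarrow> mono g \<longrightarrow> is_sup f s \<longrightarrow> is_sup g t \<longrightarrow>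
         is_sup (\<lambda>n. f n + g n) (s + t))"

definition O5 :: "'a::ordered_comm_monoid_add itself \<Rightarrow> bool" where
  "O5 _ \<longleftrightarrow> (\<forall>x y z x' y' :: 'a. x + y \<le> z \<longrightarrow> x' \<lless> x \<longrightarrow> y' \<lless> y \<longrightarrow>
      (\<exists>c. y' \<lless> c \<and> x' + c \<le> z \<and> z \<le> x + c))"

definition O6 :: "'a::ordered_comm_monoid_add itself \<Rightarrow> bool" where
  "O6 _ \<longleftrightarrow> (\<forall>x' x y z :: 'a. x' \<lless> x \<longrightarrow> x \<le> y + z \<longrightarrow>
      (\<exists>v w. v \<le> x \<and> v \<le> y \<and> w \<le> x \<and> w \<le> z \<and> x' \<le> v + w))"

definition O7 :: "'a::ordered_comm_monoid_add itself \<Rightarrow> bool" where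
  "O7 _ \<longleftrightarrow> (\<forall>x' x y' y w :: 'a. x' \<lless> x \<longrightarrow> x \<le> w \<longrightarrow> y' \<lless> y \<longrightarrow> y \<le> w \<longrightarrow>
      (\<exists>z. x' \<lless> z \<and> y' \<lless> z \<and> z \<le> w \<and> z \<le> x + y))"

definition two_omega_divisible :: "'a::ordered_comm_monoid_add itself \<Rightarrow> bool" where
  "two_omega_divisible _ \<longleftrightarrow> (\<forall>x' x :: 'a. x' \<lless> x \<longrightarrow>
      (\<exists>y. y + y \<le> x \<and> x' \<le> cu_inf y))"

definition strongly_soft :: "'a::ordered_comm_monoid_add \<Rightarrow> bool" where
  "strongly_soft x \<longleftrightarrow> (\<forall>x'. x' \<lless> x \<longrightarrow> (\<exists>t. x' + t \<lless> x \<and> x' \<lless> cu_inf t))"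

definition S_soft :: "'a::ordered_comm_monoid_add set" where
  "S_soft = {x. strongly_soft x}"

definition functionals :: "('a::ordered_comm_monoid_add \<Rightarrow> ennreal) set" where
  "functionals = {l. l 0 = 0 \<and> (\<forall>x y. l (x + y) = l x + l y) \<and> mono l \<and>
      (\<forall>f s. mono f \<longrightarrow> is_sup f s \<longrightarrow> l s = (SUP n. l (f n)))}"

definition L_set :: "'a::ordered_comm_monoid_add \<Rightarrow> 'a set" where
  "L_set x = {u'. \<exists>u \<in> S_soft. u' \<lless> u \<and> u \<lless> x}"

end

theory Submission
  imports Defs
begin

text \<open>If \<open>u\<close> is strongly soft, \<open>u' \<lless> u \<le> x\<close> and \<open>x' \<lless> x\<close>, then for arbitrarily large \<open>n\<close> there is
  a strongly soft \<open>w\<close> with \<open>u' \<lless> w \<le> x\<close> and \<open>n x' \<le> (n + 1) w\<close>. Applying this along a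
  \<open>\<lless>\<close>-increasing sequence with supremum \<open>x\<close>, and each time replacing \<open>w\<close> by an element way below it
  that still witnesses the inequality, gives an increasing sequence whose supremum is strongly soft
  and has the same value as \<open>x\<close> under every functional.\<close>

section \<open>Suprema, way-below and multiples in ordered monoids\<close>

lemma is_sup_upper: "is_sup f s \<Longrightarrow> f n \<le> s"
  by (simp add: is_sup_def)

lemma is_sup_least: "is_sup f s \<Longrightarrow> (\<And>n. f n \<le> b) \<Longrightarrow> s \<le> b"
  by (simp add: is_sup_def)

lemma is_sup_unique: "is_sup f s \<Longrightarrow> is_sup f t \<Longrightarrow> s = t"
  by (meson antisym is_sup_def)

lemma way_below_imp_le:
  fixes x y :: "'a::order"
  assumes "x \<lless> y"
  shows "x \<le> y"
proof -
  have "mono (\<lambda>_::nat. y)" "is_sup (\<lambda>_. y) y"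
    by (auto simp: mono_def is_sup_def)
  then show ?thesis
    using assms unfolding way_below_def by blast
qed

lemma le_way_below_trans: "x \<le> y \<Longrightarrow> y \<lless> z \<Longrightarrow> x \<lless> z"
  unfolding way_below_def by (meson order_trans)

lemma way_below_le_trans: "x \<lless> y \<Longrightarrow> y \<le> z \<Longrightarrow> x \<lless> z"
  unfolding way_below_def by (meson order_trans)

lemma way_below_sup_ex: "x \<lless> y \<Longrightarrow> mono f \<Longrightarrow> is_sup f y \<Longrightarrow> \<exists>m. x \<le> f m"
  unfolding way_below_def by blast

lemma nsmul_add: "nsmul (m + n) x = nsmul m x + nsmul n x"
  by (induction m) (simp_all add: add.assoc)

lemma nsmul_add_right: "nsmul n (x + y) = nsmul n x + nsmul n y"
  by (induction n) (simp_all add: ac_simps)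

lemma nsmul_mono:
  fixes x y :: "'a::ordered_comm_monoid_add"
  shows "x \<le> y \<Longrightarrow> nsmul n x \<le> nsmul n y"
  by (induction n) (simp_all add: add_mono)

section \<open>Cu-semigroups: interpolation and splitting of way-below\<close>

locale cu =
  fixes ty :: "'a::ordered_comm_monoid_add itself"
  assumes cu: "cu_semigroup TYPE('a)"
begin

lemma zero_le: "0 \<le> (x::'a)"
  using cu unfolding cu_semigroup_def by blast

lemma sup_ex: "mono f \<Longrightarrow> \<exists>s::'a. is_sup f s"
  using cu unfolding cu_semigroup_def by blast

lemma way_below_add: "x' \<lless> x \<Longrightarrow> y' \<lless> y \<Longrightarrow> x' + y' \<lless> x + (y::'a)"
  using cu unfolding cu_semigroup_def by blast

lemma is_sup_add:
  "mono f \<Longrightarrow> mono g \<Longrightarrow> is_sup f s \<Longrightarrow> is_sup g t \<Longrightarrow> is_sup (\<lambda>n. f n + g n) (s + (t::'a))"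
  using cu unfolding cu_semigroup_def by blast

lemma le_add_left: "y \<le> x + (y::'a)"
  by (simp add: add_increasing zero_le)

lemma le_add_right: "x \<le> x + (y::'a)"
  by (simp add: add_increasing2 zero_le)

lemma way_below_chain:
  "\<exists>f. mono f \<and> (\<forall>n. f n \<lless> f (Suc n)) \<and> (\<forall>n. f n \<lless> (x::'a)) \<and> is_sup f x"
proof -
  obtain f where f: "\<forall>n. f n \<lless> f (Suc n)" "is_sup f x"
    using cu unfolding cu_semigroup_def by blast
  have "mono f"
    by (simp add: f(1) mono_iff_le_Suc way_below_imp_le)
  moreover have "f n \<lless> x" for n
    using f is_sup_upper way_below_le_trans by blast
  ultimately show ?thesis
    using f by blast
qed

lemma way_below_interpolate2:
  assumes "a \<lless> x" "b \<lless> (x::'a)"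
  obtains y where "a \<lless> y" "b \<lless> y" "y \<lless> x"
proof -
  obtain f where f: "mono f" "\<And>n. f n \<lless> f (Suc n)" "\<And>n. f n \<lless> x" "is_sup f x"
    using way_below_chain[of x] by blast
  obtain i j where "a \<le> f i" "b \<le> f j"
    using assms f way_below_sup_ex by meson
  then have "a \<le> f (max i j)" "b \<le> f (max i j)"
    using f(1) by (meson max.cobounded1 max.cobounded2 monoD order_trans)+
  then show ?thesis
    using that[of "f (Suc (max i j))"] f(2,3) le_way_below_trans by blast
qed

lemma way_below_interpolate:
  assumes "a \<lless> (x::'a)"
  obtains y where "a \<lless> y" "y \<lless> x"
  using way_below_interpolate2[OF assms assms] by blast

lemma nsmul_way_below: "x \<lless> y \<Longrightarrow> nsmul n x \<lless> nsmul n (y::'a)"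
proof (induction n)
  case 0
  show ?case
    by (simp add: way_below_def zero_le)
qed (simp add: way_below_add)

lemma is_sup_nsmul: "mono f \<Longrightarrow> is_sup f s \<Longrightarrow> is_sup (\<lambda>k. nsmul n (f k)) (nsmul n (s::'a))"
proof (induction n)
  case 0
  show ?case
    by (simp add: is_sup_def)
next
  case (Suc n)
  have "mono (\<lambda>k. nsmul n (f k))"
    using Suc.prems(1) by (simp add: monoD monoI nsmul_mono)
  then show ?case
    using Suc by (simp add: is_sup_add)
qed

text \<open>By additivity of suprema, \<open>x + y\<close> is the supremum of the sums
  \<open>f n + g n\<close>. Interpolating \<open>v2\<close> first makes the resulting bound on
  \<open>v\<close> a way-below relation.\<close>

lemma way_below_add_split:
  assumes "v \<lless> x + (y::'a)"
  obtains x' y' where "x' \<lless> x" "y' \<lless> y" "v \<lless> x' + y'"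
proof -
  obtain v2 where v2: "v \<lless> v2" "v2 \<lless> x + y"
    using way_below_interpolate[OF assms] .
  obtain f where f: "mono f" "\<And>n. f n \<lless> f (Suc n)" "\<And>n. f n \<lless> x" "is_sup f x"
    using way_below_chain[of x] by blast
  obtain g where g: "mono g" "\<And>n. g n \<lless> g (Suc n)" "\<And>n. g n \<lless> y" "is_sup g y"
    using way_below_chain[of y] by blast
  have "mono (\<lambda>n. f n + g n)"
    using f(1) g(1) by (simp add: add_mono mono_def)
  then obtain m where "v2 \<le> f m + g m"
    using way_below_sup_ex[OF v2(2) _ is_sup_add[OF f(1) g(1) f(4) g(4)]] by blast
  then show ?thesis
    using that f(3) g(3) v2(1) way_below_le_trans by blast
qed

lemma way_below_nsmul_split:
  assumes "v \<lless> nsmul n (x::'a)"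
  obtains x' where "x' \<lless> x" "v \<lless> nsmul n x'"
proof -
  obtain v2 where v2: "v \<lless> v2" "v2 \<lless> nsmul n x"
    using way_below_interpolate[OF assms] .
  obtain f where f: "mono f" "\<And>n. f n \<lless> f (Suc n)" "\<And>n. f n \<lless> x" "is_sup f x"
    using way_below_chain[of x] by blast
  have "mono (\<lambda>k. nsmul n (f k))"
    using f(1) by (simp add: monoD monoI nsmul_mono)
  then obtain m where "v2 \<le> nsmul n (f m)"
    using way_below_sup_ex[OF v2(2) _ is_sup_nsmul[OF f(1,4)]] by blast
  then show ?thesis
    using that f(3) v2(1) way_below_le_trans by blast
qed

section \<open>Ideals generated by an element, and strong softness\<close>

lemma nsmul_mono_left: "m \<le> n \<Longrightarrow> nsmul m x \<le> nsmul n (x::'a)"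
  by (metis le_add_right le_iff_add nsmul_add)

text \<open>\<open>cu_inf\<close> is a definite description, so it carries information only once the
  supremum is known to exist and to be unique.\<close>

lemma cu_inf_is_sup: "is_sup (\<lambda>n. nsmul n x) (cu_inf (x::'a))"
proof -
  obtain s where "is_sup (\<lambda>n. nsmul n x) s"
    using sup_ex[of "\<lambda>n. nsmul n x"] by (auto simp: mono_def nsmul_mono_left)
  then show ?thesis
    unfolding cu_inf_def using is_sup_unique theI by metis
qed

lemma nsmul_le_cu_inf: "nsmul n x \<le> cu_inf (x::'a)"
  using cu_inf_is_sup is_sup_upper by blast

lemma le_cu_inf: "x \<le> cu_inf (x::'a)"
  using nsmul_le_cu_inf[of 1 x] by simp

text \<open>Doubling the multiples of \<open>t\<close> gives multiples of \<open>t\<close> again, so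
  \<open>cu_inf t\<close> absorbs its own double. Thus \<open>a \<le> cu_inf t\<close> serves as
  membership of \<open>a\<close> in the ideal generated by \<open>t\<close>.\<close>

lemma add_le_cu_inf:
  assumes "a \<le> cu_inf t" "b \<le> cu_inf (t::'a)"
  shows "a + b \<le> cu_inf t"
proof -
  have "mono (\<lambda>n. nsmul n t)"
    by (simp add: mono_def nsmul_mono_left)
  then have "is_sup (\<lambda>n. nsmul n t + nsmul n t) (cu_inf t + cu_inf t)"
    using is_sup_add cu_inf_is_sup by blast
  then have "cu_inf t + cu_inf t \<le> cu_inf t"
    by (rule is_sup_least) (metis nsmul_add nsmul_le_cu_inf)
  then show ?thesis
    using assms add_mono order_trans by blast
qed

lemma nsmul_le_cu_inf_of_le: "a \<le> cu_inf t \<Longrightarrow> nsmul n a \<le> cu_inf (t::'a)"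
  by (induction n) (simp_all add: zero_le add_le_cu_inf)

lemma le_cu_inf_trans:
  assumes "a \<le> cu_inf b" "b \<le> cu_inf (c::'a)"
  shows "a \<le> cu_inf c"
  using assms(1) is_sup_least[OF cu_inf_is_sup nsmul_le_cu_inf_of_le[OF assms(2)]]
  by (rule order_trans)

text \<open>An interpolant is already below a finite multiple of \<open>t\<close>, and finite
  multiples allow \<open>t\<close> to be shrunk.\<close>

lemma way_below_cu_inf_split:
  assumes "a \<lless> cu_inf (t::'a)"
  obtains t' where "t' \<lless> t" "a \<lless> cu_inf t'"
proof -
  obtain p where p: "a \<lless> p" "p \<lless> cu_inf t"
    using way_below_interpolate[OF assms] .
  have "mono (\<lambda>n. nsmul n t)"
    by (simp add: mono_def nsmul_mono_left)
  then obtain n where "p \<le> nsmul n t"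
    using way_below_sup_ex[OF p(2) _ cu_inf_is_sup] by blast
  then have "a \<lless> nsmul n t"
    using p(1) way_below_le_trans by blast
  then obtain t' where "t' \<lless> t" "a \<lless> nsmul n t'"
    by (rule way_below_nsmul_split)
  then show ?thesis
    using that nsmul_le_cu_inf way_below_le_trans by blast
qed

text \<open>Non-strict inequalities suffice: apply them to an interpolant \<open>v2\<close> of
  \<open>v\<close> and \<open>x\<close>, then shrink \<open>t\<close> to recover both way-below
  relations.\<close>

lemma strongly_softI:
  assumes "\<And>v. v \<lless> x \<Longrightarrow> \<exists>t. v + t \<le> x \<and> v \<le> cu_inf t"
  shows "strongly_soft (x::'a)"
  unfolding strongly_soft_def
proof (intro allI impI)
  fix v assume "v \<lless> x"
  then obtain v2 where v2: "v \<lless> v2" "v2 \<lless> x"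
    by (rule way_below_interpolate)
  obtain t where t: "v2 + t \<le> x" "v2 \<le> cu_inf t"
    using assms[OF v2(2)] by blast
  have "v \<lless> cu_inf t"
    using v2(1) t(2) by (rule way_below_le_trans)
  then obtain t' where "t' \<lless> t" "v \<lless> cu_inf t'"
    by (rule way_below_cu_inf_split)
  then show "\<exists>t. v + t \<lless> x \<and> v \<lless> cu_inf t"
    using v2(1) t(1) way_below_add way_below_le_trans by blast
qed

text \<open>Choose \<open>r\<close> way below \<open>s\<close> so large that its ideal contains
  \<open>c'\<close> as well as \<open>s'\<close>. The remainder \<open>t\<close> that softness of
  \<open>s\<close> gives for \<open>r\<close> then works for all of \<open>v\<close>.\<close>

lemma strongly_soft_add:
  assumes "strongly_soft s" "c \<le> cu_inf (s::'a)"
  shows "strongly_soft (s + c)"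
proof (rule strongly_softI)
  fix v assume "v \<lless> s + c"
  then obtain s' c' where 1: "s' \<lless> s" "c' \<lless> c" "v \<lless> s' + c'"
    by (rule way_below_add_split)
  have "c' \<lless> cu_inf s"
    using 1(2) assms(2) way_below_le_trans by blast
  then obtain s'' where 2: "s'' \<lless> s" "c' \<lless> cu_inf s''"
    by (rule way_below_cu_inf_split)
  obtain r where r: "s' \<lless> r" "s'' \<lless> r" "r \<lless> s"
    using way_below_interpolate2[OF 1(1) 2(1)] .
  obtain t where t: "r + t \<lless> s" "r \<lless> cu_inf t"
    using assms(1) r(3) unfolding strongly_soft_def by blast
  have r_le: "r \<le> cu_inf t" "s' \<le> r" "s'' \<le> r"
    using t r way_below_imp_le by blast+
  have s': "s' \<le> cu_inf t" "s'' \<le> cu_inf t"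
    using r_le order_trans by blast+
  then have "c' \<le> cu_inf t"
    using 2(2) le_cu_inf_trans way_below_imp_le by blast
  then have "v \<le> cu_inf t"
    by (rule order_trans[OF way_below_imp_le[OF 1(3)] add_le_cu_inf[OF s'(1)]])
  moreover have "v + t \<le> s + c"
  proof -
    have "v + t \<le> (r + t) + c'"
      using add_mono[OF order_trans[OF way_below_imp_le[OF 1(3)] add_right_mono[OF r_le(2)]] order_refl[of t]]
      by (simp add: ac_simps)
    also have "\<dots> \<le> s + c"
      using t(1) 1(2) by (simp add: add_mono way_below_imp_le)
    finally show ?thesis .
  qed
  ultimately show "\<exists>t. v + t \<le> s + c \<and> v \<le> cu_inf t"
    by blast
qed

end

section \<open>Divisibility and the construction of soft elements\<close>

locale divisible_cu = cu ty for ty :: "'a::ordered_comm_monoid_add itself" +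
  assumes div: "two_omega_divisible TYPE('a)"
begin

lemma halve:
  assumes "x' \<lless> (x::'a)"
  obtains y' y where "y + y \<le> x" "y' \<lless> y" "x' \<lless> cu_inf y'"
proof -
  obtain x2 where x2: "x' \<lless> x2" "x2 \<lless> x"
    using way_below_interpolate[OF assms] .
  obtain y where "y + y \<le> x" "x2 \<le> cu_inf y"
    using div x2(2) unfolding two_omega_divisible_def by blast
  then show ?thesis
    using that x2(1) way_below_cu_inf_split way_below_le_trans by metis
qed

text \<open>Each halving is applied to \<open>y' \<lless> y\<close>, so the new ideal still contains
  \<open>y'\<close> and hence \<open>x'\<close>.\<close>

lemma divide_pow2:
  assumes "x' \<lless> (x::'a)"
  shows "\<exists>y' y. nsmul (2 ^ k) y \<le> x \<and> y' \<lless> y \<and> x' \<lless> cu_inf y'"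
proof (induction k)
  case 0
  obtain x'' where "x' \<lless> x''" "x'' \<lless> x"
    using way_below_interpolate[OF assms] .
  then show ?case
    using le_cu_inf way_below_le_trans by (intro exI[of _ x''] exI[of _ x]) auto
next
  case (Suc k)
  then obtain y' y where y: "nsmul (2 ^ k) y \<le> x" "y' \<lless> y" "x' \<lless> cu_inf y'"
    by blast
  obtain z' z where z: "z + z \<le> y" "z' \<lless> z" "y' \<lless> cu_inf z'"
    using halve[OF y(2)] .
  have "nsmul (2 ^ Suc k) z = nsmul (2 ^ k) (z + z)"
    by (simp add: nsmul_add nsmul_add_right mult_2)
  also have "\<dots> \<le> x"
    using nsmul_mono[OF z(1)] y(1) by (rule order_trans)
  finally have "nsmul (2 ^ Suc k) z \<le> x" .
  moreover have "x' \<lless> cu_inf z'"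
    using y(3) z(3) le_cu_inf_trans order_refl way_below_imp_le way_below_le_trans by meson
  ultimately show ?case
    using z(2) by blast
qed

text \<open>Halving repeatedly gives \<open>b\<^sub>k \<lless> a\<^sub>k\<close> with \<open>2 a\<^sub>k\<^sub>+\<^sub>1 \<le> a\<^sub>k\<close> and \<open>b\<^sub>k \<lless> \<infinity> b\<^sub>k\<^sub>+\<^sub>1\<close>; the element
  \<open>b\<^sub>0 + b\<^sub>1 + \<dots>\<close> lies below \<open>x\<close>, and it is soft because each \<open>b\<^sub>k\<close> generates an ideal containing
  the preceding partial sums.\<close>

lemma strongly_soft_below:
  assumes "x' \<lless> (x::'a)"
  obtains s where "strongly_soft s" "s \<le> x" "x' \<le> cu_inf s"
proof -
  obtain y' y where y: "y + y \<le> x" "y' \<lless> y" "x' \<lless> cu_inf y'"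
    using halve[OF assms] .
  \<comment> \<open>Pairs stand for \<open>(b\<^sub>k, a\<^sub>k)\<close>: \<open>A\<close> is the
    invariant on one pair, \<open>B\<close> links consecutive pairs.\<close>
  define A where "A p \<longleftrightarrow> fst p \<lless> snd p \<and> x' \<lless> cu_inf (fst p) \<and> snd p + snd p \<le> x" for p
  define B where "B p q \<longleftrightarrow> snd q + snd q \<le> snd p \<and> fst p \<lless> cu_inf (fst q)" for p q :: "'a \<times> 'a"
  have "\<exists>f. \<forall>n. A (f n) \<and> B (f n) (f (Suc n))"
  proof (rule dependent_nat_choice)
    show "\<exists>p. A p"
      using y by (intro exI[of _ "(y', y)"]) (simp add: A_def)
  next
    fix p and n :: nat
    assume p: "A p"
    then obtain b' b where b: "b + b \<le> snd p" "b' \<lless> b" "fst p \<lless> cu_inf b'"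
      using halve unfolding A_def by blast
    have "cu_inf (fst p) \<le> cu_inf b'"
      using b(3) le_cu_inf_trans[OF order_refl] way_below_imp_le by blast
    then have "x' \<lless> cu_inf b'"
      using p way_below_le_trans unfolding A_def by blast
    moreover have "snd p \<le> x"
      using p order_trans[OF le_add_left] unfolding A_def by blast
    ultimately show "\<exists>q. A q \<and> B p q"
      using b order_trans[OF b(1)] by (intro exI[of _ "(b', b)"]) (simp add: A_def B_def)
  qed
  then obtain f where f: "\<forall>n. A (f n) \<and> B (f n) (f (Suc n))" ..
  define a where "a n = snd (f n)" for n
  define b where "b n = fst (f n)" for n
  have ab: "b n \<lless> a n" "x' \<lless> cu_inf (b n)" "a n + a n \<le> x"
      "a (Suc n) + a (Suc n) \<le> a n" "b n \<lless> cu_inf (b (Suc n))" for n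
    using f by (simp_all add: A_def B_def a_def b_def)
  define p where "p n = sum b {..<n}" for n
  have p_Suc: "p (Suc n) = p n + b n" for n
    by (simp add: p_def add.commute)
  have "mono p"
    by (simp add: mono_iff_le_Suc p_Suc le_add_right)
  then obtain s where s: "is_sup p s"
    using sup_ex by blast
  \<comment> \<open>Two copies of \<open>a n\<close> are kept in reserve: one pays for
    \<open>b n\<close>, the other for both copies of \<open>a (Suc n)\<close>.\<close>
  have p_a: "p n + (a n + a n) \<le> x" for n
  proof (induction n)
    case 0
    then show ?case using ab(3) by (simp add: p_def)
  next
    case (Suc n)
    have "p (Suc n) + (a (Suc n) + a (Suc n)) \<le> (p n + a n) + a n"
      unfolding p_Suc using ab(1)[of n] ab(4)[of n] way_below_imp_le add_mono order_refl by metis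
    then show ?case
      using Suc by (simp add: add.assoc)
  qed
  have p_inf: "p n \<le> cu_inf (b n)" for n
  proof (induction n)
    case 0
    then show ?case by (simp add: p_def zero_le)
  next
    case (Suc n)
    have "b n \<le> cu_inf (b (Suc n))"
      using ab(5) way_below_imp_le by blast
    then show ?case
      unfolding p_Suc using Suc le_cu_inf_trans add_le_cu_inf by blast
  qed
  have "s \<le> x"
    using s p_a le_add_right order_trans by (metis is_sup_least)
  moreover have "x' \<le> cu_inf s"
  proof -
    have "b 0 \<le> s"
      using is_sup_upper[OF s, of 1] by (simp add: p_def)
    then show ?thesis
      using ab(2)[of 0] le_cu_inf le_cu_inf_trans order_trans way_below_imp_le by meson
  qed
  moreover have "strongly_soft s"
  proof (rule strongly_softI)
    fix v assume "v \<lless> s"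
    then obtain n where n: "v \<le> p n"
      using way_below_sup_ex[OF _ \<open>mono p\<close> s] by blast
    have "v + b n \<le> p (Suc n)"
      unfolding p_Suc using n by (rule add_right_mono)
    then have "v + b n \<le> s"
      using is_sup_upper[OF s] order_trans by blast
    then show "\<exists>t. v + t \<le> s \<and> v \<le> cu_inf t"
      using n p_inf order_trans by blast
  qed
  ultimately show ?thesis
    using that by blast
qed

end

section \<open>Soft approximation from below using (O5), (O6) and (O7)\<close>

locale divisible_cu_O567 = divisible_cu ty for ty :: "'a::ordered_comm_monoid_add itself" +
  assumes O5: "O5 TYPE('a)" and O6: "O6 TYPE('a)" and O7: "O7 TYPE('a)"
begin

lemma O5E:
  assumes "x + y \<le> (z::'a)" "x' \<lless> x" "y' \<lless> y"
  obtains c where "y' \<lless> c" "x' + c \<le> z" "z \<le> x + c"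
  using O5 assms unfolding O5_def by blast

lemma O6E:
  assumes "x' \<lless> x" "x \<le> y + (z::'a)"
  obtains v w where "v \<le> x" "v \<le> y" "w \<le> x" "w \<le> z" "x' \<le> v + w"
  using O6 assms unfolding O6_def by blast

lemma O7E:
  assumes "x' \<lless> x" "x \<le> w" "y' \<lless> y" "y \<le> (w::'a)"
  obtains z where "x' \<lless> z" "y' \<lless> z" "z \<le> w" "z \<le> x + y"
  using O7 assms unfolding O7_def by blast

text \<open>Softness leaves room for \<open>t\<close> beside \<open>u''\<close>, with
  \<open>u''\<close> in the ideal of \<open>t'\<close>. The complement \<open>c\<close> from (O5)
  dominates \<open>t'\<close>, so its ideal contains \<open>u''\<close>, and then \<open>x\<close>
  because \<open>x \<le> u'' + c\<close>.\<close>

lemma soft_full_complement: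
  assumes "strongly_soft u" "u' \<lless> u" "u \<le> (x::'a)"
  obtains c where "u' + c \<le> x" "x \<le> cu_inf c"
proof -
  obtain u'' where u'': "u' \<lless> u''" "u'' \<lless> u"
    using way_below_interpolate[OF assms(2)] .
  obtain t where t: "u'' + t \<lless> u" "u'' \<lless> cu_inf t"
    using assms(1) u''(2) unfolding strongly_soft_def by blast
  obtain t' where t': "t' \<lless> t" "u'' \<lless> cu_inf t'"
    using way_below_cu_inf_split[OF t(2)] .
  have "u'' + t \<le> x"
    using t(1) assms(3) way_below_imp_le order_trans by blast
  then obtain c where c: "t' \<lless> c" "u' + c \<le> x" "x \<le> u'' + c"
    using u''(1) t'(1) by (rule O5E)
  have "u'' \<le> cu_inf c"
    using t'(2) c(1) le_cu_inf le_cu_inf_trans order_trans way_below_imp_le by meson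
  then have "x \<le> cu_inf c"
    using c(3) add_le_cu_inf le_cu_inf order_trans by blast
  with c(2) show ?thesis
    using that by blast
qed

text \<open>With \<open>N = n + 1\<close> a power of two, \<open>N s + u' \<le> x\<close> and \<open>s\<close> almost full, (O5) yields \<open>c\<close> with
  \<open>s\<^sub>0 + c \<le> x \<le> s\<^sub>1 + c\<close> and \<open>u' + n s\<^sub>1 \<le> c\<close>, so that \<open>n x \<le> N c\<close>. (O6) and (O7) shrink \<open>c\<close>
  to an element \<open>z\<close> of the ideal generated by the soft element \<open>s\<^sub>0\<close>, which makes \<open>s\<^sub>0 + z\<close> soft.\<close>

lemma soft_approximation:
  assumes u: "strongly_soft u" "u' \<lless> u" "u \<le> x" and x': "x' \<lless> (x::'a)"
    and n: "Suc n = 2 ^ k"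
  obtains w where "strongly_soft w" "u' \<lless> w" "w \<le> x" "nsmul n x' \<le> nsmul (Suc n) w"
proof -
  \<comment> \<open>(O5) and (O7) each cost one way-below step: (O5) passes from \<open>u2\<close>
    to \<open>u1\<close>, (O7) from \<open>u1\<close> to \<open>u'\<close>.\<close>
  obtain u1 where u1: "u' \<lless> u1" "u1 \<lless> u"
    using way_below_interpolate[OF u(2)] .
  obtain u2 where u2: "u1 \<lless> u2" "u2 \<lless> u"
    using way_below_interpolate[OF u1(2)] .
  have "u1 \<lless> x"
    using u1(2) u(3) way_below_le_trans by blast
  \<comment> \<open>\<open>x1\<close> dominates both \<open>x'\<close> and \<open>u1\<close>, so
    that every summand in the later bound on \<open>z\<close> lies in the ideal of
    \<open>s0\<close>.\<close>
  then obtain x1 where x1: "x' \<lless> x1" "u1 \<lless> x1" "x1 \<lless> x"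
    using way_below_interpolate2[OF x'] by blast
  obtain d where d: "u2 + d \<le> x" "x \<le> cu_inf d"
    using soft_full_complement[OF u(1) u2(2) u(3)] .
  have "x1 \<lless> cu_inf d"
    using x1(3) d(2) way_below_le_trans by blast
  then obtain d' where d': "d' \<lless> d" "x1 \<lless> cu_inf d'"
    by (rule way_below_cu_inf_split)
  obtain s' s where s: "nsmul (Suc n) s \<le> d" "s' \<lless> s" "d' \<lless> cu_inf s'"
    using divide_pow2[OF d'(1), of k] unfolding n by blast
  obtain r1 where r1: "s' \<lless> r1" "r1 \<lless> s"
    using way_below_interpolate[OF s(2)] .
  obtain s1 where s1: "r1 \<lless> s1" "s1 \<lless> s"
    using way_below_interpolate[OF r1(2)] .
  \<comment> \<open>Staying below \<open>r1\<close> ensures \<open>s0 \<lless> s1\<close>, as (O5)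
    requires.\<close>
  obtain s0 where s0: "strongly_soft s0" "s0 \<le> r1" "s' \<le> cu_inf s0"
    using strongly_soft_below[OF r1(1)] .
  have x1_s0: "x1 \<le> cu_inf s0"
    using d'(2) s(3) s0(3) le_cu_inf_trans way_below_imp_le by blast
  \<comment> \<open>Of the \<open>Suc n\<close> copies of \<open>s\<close> inside \<open>d\<close>,
    one makes room for \<open>s1\<close>; the other \<open>n\<close> join \<open>u2\<close> in the
    part that (O5) recovers below \<open>c\<close>.\<close>
  have "s1 + (u2 + nsmul n s) \<le> x"
  proof -
    have "s1 + (u2 + nsmul n s) \<le> s + (u2 + nsmul n s)"
      using s1(2) by (simp add: add_right_mono way_below_imp_le)
    also have "\<dots> = u2 + nsmul (Suc n) s"
      by (simp add: ac_simps)
    also have "\<dots> \<le> x"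
      using s(1) d(1) add_left_mono order_trans by blast
    finally show ?thesis .
  qed
  moreover have "s0 \<lless> s1"
    using s0(2) s1(1) le_way_below_trans by blast
  moreover have "u1 + nsmul n s1 \<lless> u2 + nsmul n s"
    using u2(1) s1(2) by (simp add: nsmul_way_below way_below_add)
  ultimately obtain c where c: "u1 + nsmul n s1 \<lless> c" "s0 + c \<le> x" "x \<le> s1 + c"
    by (rule O5E)
  obtain x2 where x2: "x' \<lless> x2" "x2 \<lless> x1"
    using way_below_interpolate[OF x1(1)] .
  have "x1 \<le> s1 + c"
    using x1(3) c(3) order_trans way_below_imp_le by blast
  \<comment> \<open>(O6) covers \<open>x2\<close> by \<open>v\<close>, whose \<open>n\<close>-fold
    multiple fits under \<open>c\<close> together with \<open>u1\<close>, and by \<open>e\<close>,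
    which is itself below \<open>c\<close>.\<close>
  with x2(2) obtain v e where ve: "v \<le> x1" "v \<le> s1" "e \<le> x1" "e \<le> c" "x2 \<le> v + e"
    by (rule O6E)
  have "x' \<lless> v + e"
    using x2(1) ve(5) by (rule way_below_le_trans)
  then obtain v' e' where ve': "v' \<lless> v" "e' \<lless> e" "x' \<lless> v' + e'"
    by (rule way_below_add_split)
  have "u' + nsmul n v' \<lless> u1 + nsmul n v"
    using u1(1) ve'(1) by (simp add: nsmul_way_below way_below_add)
  moreover have "u1 + nsmul n v \<le> c"
    using c(1) ve(2) by (meson add_left_mono nsmul_mono order_trans way_below_imp_le)
  ultimately obtain z where z: "e' \<lless> z" "u' + nsmul n v' \<lless> z" "z \<le> c"
      "z \<le> e + (u1 + nsmul n v)"
    by (rule O7E[OF ve'(2) ve(4)])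
  have in_ideal: "y \<le> cu_inf s0" if "y \<le> x1" for y
    using that x1_s0 order_trans by blast
  have "e + (u1 + nsmul n v) \<le> cu_inf s0"
    using in_ideal[OF ve(3)] in_ideal[OF ve(1)] in_ideal[OF way_below_imp_le[OF x1(2)]]
    by (simp add: add_le_cu_inf nsmul_le_cu_inf_of_le)
  then have "strongly_soft (s0 + z)"
    using s0(1) strongly_soft_add z(4) order_trans by blast
  moreover have "u' \<lless> s0 + z"
  proof -
    have "u' \<lless> z"
      using z(2) le_add_right le_way_below_trans by blast
    then show ?thesis
      using le_add_left way_below_le_trans by blast
  qed
  moreover have "s0 + z \<le> x"
    using z(3) c(2) add_left_mono order_trans by blast
  moreover have "nsmul n x' \<le> nsmul (Suc n) (s0 + z)"
  proof -
    \<comment> \<open>The one extra copy of \<open>z\<close> absorbs all of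
      \<open>nsmul n v'\<close>; the other \<open>n\<close> copies absorb
      \<open>nsmul n e'\<close>.\<close>
    have "nsmul n x' \<le> nsmul n v' + nsmul n e'"
      using nsmul_mono[OF way_below_imp_le[OF ve'(3)]] by (simp add: nsmul_add_right)
    also have "\<dots> \<le> z + nsmul n z"
      using z(1,2) by (meson add_mono le_add_left nsmul_mono order_trans way_below_imp_le)
    also have "\<dots> \<le> nsmul (Suc n) (s0 + z)"
      using nsmul_mono[OF le_add_left, of "Suc n" z s0] by simp
    finally show ?thesis .
  qed
  ultimately show ?thesis
    using that by blast
qed

end

section \<open>Functionals and the limit of the approximations\<close>

lemma functional_nsmul:
  assumes "l \<in> functionals"
  shows "l (nsmul n x) = of_nat n * l x"
  using assms by (induction n) (simp_all add: functionals_def distrib_right)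

text \<open>After division by \<open>2 ^ Suc n\<close> the factor on \<open>a\<close> tends to 1.
  Infinite values are excluded first, so that the limit argument runs in the reals.\<close>

lemma ennreal_le_of_approx:
  fixes a b :: ennreal
  assumes "\<And>n. n \<ge> m \<Longrightarrow> of_nat (2 ^ Suc n - 1) * a \<le> of_nat (2 ^ Suc n) * b"
  shows "a \<le> b"
proof (cases "b = top")
  case False
  then obtain q where q: "b = ennreal q" "0 \<le> q"
    by (cases b) auto
  have "a \<noteq> top"
  proof
    assume "a = top"
    moreover have "of_nat (2 ^ Suc m - 1) \<noteq> (0::ennreal)"
      using one_less_power[of "2::nat" "Suc m"] by (simp del: power_Suc)
    ultimately have "of_nat (2 ^ Suc m) * b = top"
      using assms[of m] by (simp add: ennreal_mult_top top_unique del: power_Suc of_nat_diff)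
    then show False
      using False by (simp add: ennreal_mult_eq_top_iff power_eq_top_ennreal)
  qed
  then obtain p where p: "a = ennreal p" "0 \<le> p"
    by (cases a) auto
  have real_approx: "(2 ^ Suc n - 1) * p \<le> 2 ^ Suc n * q" if "n \<ge> m" for n
  proof -
    have "ennreal (real (2 ^ Suc n - 1) * p) \<le> ennreal (real (2 ^ Suc n) * q)"
      using assms[OF that] p q by (simp only: ennreal_mult of_nat_0_le_iff ennreal_of_nat_eq_real_of_nat)
    then have "real (2 ^ Suc n - 1) * p \<le> real (2 ^ Suc n) * q"
      using q by (subst (asm) ennreal_le_iff) simp_all
    then show ?thesis
      by (simp add: of_nat_diff)
  qed
  have "p \<le> q"
  proof (rule ccontr)
    assume "\<not> p \<le> q"
    \<comment> \<open>The estimates bound \<open>2 ^ Suc n * (p - q)\<close> by \<open>p\<close>,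
      which fails for large \<open>n\<close> if \<open>q < p\<close>; taking \<open>max k m\<close>
      below keeps the hypothesis applicable.\<close>
    then obtain k where k: "p / (p - q) < 2 ^ k"
      using real_arch_pow[of 2 "p / (p - q)"] by auto
    have "(2::real) ^ k \<le> 2 ^ Suc (max k m)"
      by (intro power_increasing) auto
    then have "p / (p - q) < 2 ^ Suc (max k m)"
      using k by linarith
    then have "p < 2 ^ Suc (max k m) * (p - q)"
      using \<open>\<not> p \<le> q\<close> by (simp add: pos_divide_less_eq del: power_Suc)
    then show False
      using real_approx[of "max k m"] by (simp add: algebra_simps del: power_Suc)
  qed
  then show ?thesis
    using p q by (simp add: ennreal_leI)
qed simp

theorem theorem5p10:
  fixes x u' :: "'a::ordered_comm_monoid_add"
  assumes "cu_semigroup TYPE('a)"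
    and "two_omega_divisible TYPE('a)"
    and "O5 TYPE('a)" and "O6 TYPE('a)" and "O7 TYPE('a)"
    and "u' \<in> L_set x"
  shows "\<exists>w \<in> S_soft. u' \<lless> w \<and> w \<le> x \<and> x \<le> cu_inf w \<and>
           (\<forall>l \<in> functionals. l w = l x)"
proof -
  interpret divisible_cu_O567 "TYPE('a)"
    using assms by unfold_locales
  obtain f where f: "mono f" "\<And>n. f n \<lless> f (Suc n)" "\<And>n. f n \<lless> x" "is_sup f x"
    using way_below_chain[of x] by blast
  \<comment> \<open>Weaker than membership in \<open>L_set x\<close>: the soft elements constructed
    later are only known to satisfy \<open>u \<le> x\<close>.\<close>
  define P where "P a \<longleftrightarrow> (\<exists>u. strongly_soft u \<and> a \<lless> u \<and> u \<le> x)" for a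
  \<comment> \<open>\<open>Suc (N n)\<close> is a power of two, to match repeated halving, and
    \<open>N n\<close> is unbounded.\<close>
  define N :: "nat \<Rightarrow> nat" where "N n = 2 ^ Suc n - 1" for n
  have N: "Suc (N n) = 2 ^ Suc n" for n
    by (simp add: N_def)
  \<comment> \<open>The witness \<open>t\<close> makes the supremum of the chain soft; the last
    conjunct controls its ideal and its values under functionals.\<close>
  define Q where "Q n a b \<longleftrightarrow> a \<lless> b \<and> (\<exists>t. a + t \<le> b \<and> a \<le> cu_inf t) \<and>
      nsmul (N n) (f n) \<le> nsmul (Suc (N n)) b" for n a b
  have "P u'"
    using assms(6) way_below_imp_le unfolding P_def L_set_def S_soft_def by blast
  have "\<exists>g. \<forall>n. (P (g n) \<and> u' \<le> g n) \<and> Q n (g n) (g (Suc n))"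
  proof (rule dependent_nat_choice)
    show "\<exists>a. P a \<and> u' \<le> a"
      using \<open>P u'\<close> by blast
  next
    fix a n assume a: "P a \<and> u' \<le> a"
    then obtain u where u: "strongly_soft u" "a \<lless> u" "u \<le> x"
      unfolding P_def by blast
    \<comment> \<open>Approximating \<open>f (Suc n)\<close> leaves the gap
      \<open>f n \<lless> f (Suc n)\<close> needed to replace \<open>w\<close> by an element way
      below it.\<close>
    obtain w where w: "strongly_soft w" "a \<lless> w" "w \<le> x"
        "nsmul (N n) (f (Suc n)) \<le> nsmul (Suc (N n)) w"
      using soft_approximation[OF u f(3) N] .
    obtain t where t: "a + t \<lless> w" "a \<lless> cu_inf t"
      using w(1,2) unfolding strongly_soft_def by blast
    have "nsmul (N n) (f n) \<lless> nsmul (Suc (N n)) w"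
      using nsmul_way_below[OF f(2)] w(4) way_below_le_trans by blast
    then obtain w' where w': "w' \<lless> w" "nsmul (N n) (f n) \<lless> nsmul (Suc (N n)) w'"
      by (rule way_below_nsmul_split)
    \<comment> \<open>Two interpolations place \<open>b\<close> above \<open>a\<close>,
      \<open>w'\<close> and \<open>a + t\<close> but way below \<open>w\<close>, so \<open>w\<close>
      itself witnesses \<open>P b\<close>.\<close>
    obtain b1 where b1: "a \<lless> b1" "w' \<lless> b1" "b1 \<lless> w"
      using way_below_interpolate2[OF w(2) w'(1)] .
    obtain b where b: "b1 \<lless> b" "a + t \<lless> b" "b \<lless> w"
      using way_below_interpolate2[OF b1(3) t(1)] .
    have "a \<lless> b" "w' \<le> b"
      using b1 b(1) way_below_imp_le way_below_le_trans by blast+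
    moreover from this have "nsmul (N n) (f n) \<le> nsmul (Suc (N n)) b"
      by (intro order_trans[OF way_below_imp_le[OF w'(2)] nsmul_mono])
    ultimately have "Q n a b"
      unfolding Q_def using b(2) t(2) way_below_imp_le by blast
    moreover have "P b"
      unfolding P_def using w b(3) by blast
    moreover have "u' \<le> b"
      using a \<open>a \<lless> b\<close> order_trans way_below_imp_le by blast
    ultimately show "\<exists>b. (P b \<and> u' \<le> b) \<and> Q n a b"
      by blast
  qed
  then obtain g where P: "\<And>n. P (g n)" and u': "\<And>n. u' \<le> g n" and Q: "\<And>n. Q n (g n) (g (Suc n))"
    by blast
  have step: "g n \<lless> g (Suc n)" for n
    using Q unfolding Q_def by blast
  then have "mono g"
    by (simp add: mono_iff_le_Suc way_below_imp_le)
  then obtain w where w: "is_sup g w"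
    using sup_ex by blast
  have approx: "nsmul (N n) (f n) \<le> nsmul (Suc (N n)) w" for n
    using Q[of n] nsmul_mono[OF is_sup_upper[OF w]] order_trans unfolding Q_def by blast
  have "strongly_soft w"
  proof (rule strongly_softI)
    fix v assume "v \<lless> w"
    then obtain n where n: "v \<le> g n"
      using way_below_sup_ex[OF _ \<open>mono g\<close> w] by blast
    obtain t where t: "g n + t \<le> g (Suc n)" "g n \<le> cu_inf t"
      using Q unfolding Q_def by blast
    have "v + t \<le> w"
      using n t(1) is_sup_upper[OF w] add_right_mono order_trans by metis
    then show "\<exists>t. v + t \<le> w \<and> v \<le> cu_inf t"
      using n t(2) order_trans by blast
  qed
  moreover have "u' \<lless> w"
    using u' step is_sup_upper[OF w] le_way_below_trans way_below_le_trans by blast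
  moreover have "w \<le> x"
    by (rule is_sup_least[OF w]) (use P way_below_imp_le order_trans in \<open>unfold P_def, blast\<close>)
  moreover have "x \<le> cu_inf w"
  proof (rule is_sup_least[OF f(4)])
    fix n
    have "1 \<le> N n"
      using N[of n] by (cases "N n") auto
    then have "f n \<le> nsmul (N n) (f n)"
      using nsmul_mono_left[of 1 "N n" "f n"] by simp
    also note approx[of n]
    also note nsmul_le_cu_inf
    finally show "f n \<le> cu_inf w" .
  qed
  moreover have "l w = l x" if l: "l \<in> functionals" for l
  proof (rule antisym)
    have mono: "mono l" and sup: "l x = (SUP n. l (f n))"
      using l f(1,4) unfolding functionals_def by blast+
    show "l w \<le> l x"
      using mono \<open>w \<le> x\<close> by (rule monoD)
    show "l x \<le> l w"
      unfolding sup
    proof (rule SUP_least)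
      fix m
      show "l (f m) \<le> l w"
      proof (rule ennreal_le_of_approx)
        \<comment> \<open>For fixed \<open>m\<close>, the bound at stage \<open>n\<close> applies to
          \<open>f m \<le> f n\<close>, and the multiplicities grow with \<open>n\<close>.\<close>
        fix n assume "m \<le> n"
        then have "l (nsmul (N n) (f m)) \<le> l (nsmul (Suc (N n)) w)"
          using approx[of n] nsmul_mono[OF monoD[OF f(1)]] order_trans monoD[OF mono] by metis
        then show "of_nat (2 ^ Suc n - 1) * l (f m) \<le> of_nat (2 ^ Suc n) * l w"
          unfolding functional_nsmul[OF l] N by (simp add: N_def)
      qed
    qed
  qed
  ultimately show ?thesis
    unfolding S_soft_def by blast
qed

end
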